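(* Assume $\eta_n\to0$. Let $\hat\theta$ stand for any one of $\hat\theta_H$, $\hat\theta_S$, $\hat\theta_{SCAD}$. Then $\hat\theta$ is uniformly consistent, i.e., $$\lim_{n\to\infty}\sup_{\theta\in\mathbb{R}}P_{n,\theta}\left(|\hat\theta-\theta|>\varepsilon\right)=0\quad\text{for every }\varepsilon>0.$$ In fact, for every $\varepsilon>0$ this supremum converges to zero exponentially fast, i.e., there are constants $C,\kappa>0$ (possibly depending on $\varepsilon$ and on the sequence $(\eta_n)$) such that the supremum is at most $Ce^{-\kappa n}$ for all $n$. Furthermore, set $a_n=\min\{n^{1/2},\eta_n^{-1}\}$. Then for every $\varepsilon>0$ there exists a nonnegative real number $M$ such that $$\sup_{n\in\mathbb{N}}\sup_{\theta\in\mathbb{R}}P_{n,\theta}\left(a_n|\hat\theta-\theta|>M\right)<\varepsilon,$$ i.e., $\hat\theta$ is uniformly $\min\{n^{1/2},\eta_n^{-1}\}$-consistent.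
   Context: For each $n\ge1$ and $\theta\in\mathbb{R}$, $P_{n,\theta}$ is the probability measure under which $y_1,\dots,y_n$ are independent and each $N(\theta,1)$-distributed; $\bar y=n^{-1}\sum_{t=1}^n y_t$. $(\eta_n)$ is a sequence of positive real numbers (tuning parameters). $\boldsymbol{1}(\cdot)$ is the indicator function, $z_+=\max\{z,0\}$, and $\mathrm{sign}(x)=-1,0,1$ for $x<0$, $x=0$, $x>0$. The estimators (at sample size $n$) are: hard-thresholding $\hat\theta_H=\bar y\,\boldsymbol{1}(|\bar y|>\eta_n)$; soft-thresholding (LASSO) $\hat\theta_S=\mathrm{sign}(\bar y)(|\bar y|-\eta_n)_+$; and, for a fixed constant $a>2$, SCAD: $\hat\theta_{SCAD}=\mathrm{sign}(\bar y)(|\bar y|-\eta_n)_+$ if $|\bar y|\le 2\eta_n$, $\hat\theta_{SCAD}=\{(a-1)\bar y-\mathrm{sign}(\bar y)a\eta_n\}/(a-2)$ if $2\eta_n<|\bar y|\le a\eta_n$, and $\hat\theta_{SCAD}=\bar y$ if $|\bar y|>a\eta_n$. *)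

theory Defs
  imports "HOL-Probability.Probability"
begin

text \<open>A sample of size \<open>n\<close> is a function \<open>y\<close> on the index set \<open>{1..n}\<close>; the observations are the
  coordinates \<open>y 1, \<dots>, y n\<close>.  Under the product measure below they are independent, each with
  distribution \<open>N(\<theta>, 1)\<close>.\<close>

definition sample_measure :: "nat \<Rightarrow> real \<Rightarrow> (nat \<Rightarrow> real) measure" where
  "sample_measure n \<theta> = (\<Pi>\<^sub>M t\<in>{1..n}. density lborel (normal_density \<theta> 1))"

definition sample_mean :: "nat \<Rightarrow> (nat \<Rightarrow> real) \<Rightarrow> real" where
  "sample_mean n y = (\<Sum>t=1..n. y t) / real n"

text \<open>Each estimator takes the whole sequence \<open>\<eta>\<close> of tuning parameters, the sample size and the sample.\<close>

definition hard_threshold :: "(nat \<Rightarrow> real) \<Rightarrow> nat \<Rightarrow> (nat \<Rightarrow> real) \<Rightarrow> real" where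
  "hard_threshold \<eta> n y = sample_mean n y * of_bool (\<bar>sample_mean n y\<bar> > \<eta> n)"

definition soft_threshold :: "(nat \<Rightarrow> real) \<Rightarrow> nat \<Rightarrow> (nat \<Rightarrow> real) \<Rightarrow> real" where
  "soft_threshold \<eta> n y = sgn (sample_mean n y) * max (\<bar>sample_mean n y\<bar> - \<eta> n) 0"

definition scad :: "real \<Rightarrow> (nat \<Rightarrow> real) \<Rightarrow> nat \<Rightarrow> (nat \<Rightarrow> real) \<Rightarrow> real" where
  "scad a \<eta> n y =
     (if \<bar>sample_mean n y\<bar> \<le> 2 * \<eta> n then
        sgn (sample_mean n y) * max (\<bar>sample_mean n y\<bar> - \<eta> n) 0
      else if \<bar>sample_mean n y\<bar> \<le> a * \<eta> n then
        ((a - 1) * sample_mean n y - sgn (sample_mean n y) * a * \<eta> n) / (a - 2)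
      else sample_mean n y)"

text \<open>The next facts show that the probabilities in question are probabilities of measurable events,
  and that the real suprema taken over them are suprema of bounded sets.\<close>

lemma prob_space_sample_measure: "prob_space (sample_measure n \<theta>)"
  unfolding sample_measure_def by (intro prob_space_PiM prob_space_normal_density) simp

lemma prob_sample_measure_bounds:
  "0 \<le> measure (sample_measure n \<theta>) A" "measure (sample_measure n \<theta>) A \<le> 1"
  using prob_space.prob_le_1[OF prob_space_sample_measure] by auto

lemma measurable_sample_mean [measurable]:
  "sample_mean n \<in> borel_measurable (sample_measure n \<theta>)"
proof -
  have [measurable]: "(\<lambda>y. y t) \<in> borel_measurable (sample_measure n \<theta>)" if "t \<in> {1..n}" for t
  proof -
    have "(\<lambda>y. y t) \<in> measurable (sample_measure n \<theta>) (density lborel (normal_density \<theta> 1))"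
      unfolding sample_measure_def by (rule measurable_component_singleton[OF that])
    then show ?thesis by simp
  qed
  show ?thesis unfolding sample_mean_def by measurable
qed

lemma measurable_estimators [measurable]:
  "hard_threshold \<eta> n \<in> borel_measurable (sample_measure n \<theta>)"
  "soft_threshold \<eta> n \<in> borel_measurable (sample_measure n \<theta>)"
  "scad a \<eta> n \<in> borel_measurable (sample_measure n \<theta>)"
  unfolding hard_threshold_def soft_threshold_def scad_def of_bool_def sgn_real_def
  by measurable

end

theory Submission
  imports Defs
begin

text \<open>Each estimator differs from the sample mean by at most \<open>\<eta> n\<close>, so every claim reduces to the
  Gaussian tail bound \<open>P(\<bar>sample mean - \<theta>\<bar> \<ge> t) \<le> 2 exp (- n t\<^sup>2 / 2)\<close>, which is uniform in \<open>\<theta>\<close>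
  and follows from Chernoff's method.\<close>

section \<open>Exponential moments and Gaussian tails of the sample mean\<close>

text \<open>Completing the square: tilting a unit-variance Gaussian exponentially shifts its mean by
  \<open>l\<close>. The moment generating function then reduces to the total mass of a shifted
  density.\<close>

lemma normal_density_exp_tilt:
  "exp (l * (x - \<theta>)) * normal_density \<theta> 1 x = exp (l\<^sup>2 / 2) * normal_density (\<theta> + l) 1 x"
proof -
  have "l * (x - \<theta>) + - ((x - \<theta>)\<^sup>2 / 2) = l\<^sup>2 / 2 + - ((x - (\<theta> + l))\<^sup>2 / 2)"
    by (simp add: power2_eq_square field_simps)
  then have "exp (l * (x - \<theta>)) * exp (- ((x - \<theta>)\<^sup>2 / 2)) =
      exp (l\<^sup>2 / 2) * exp (- ((x - (\<theta> + l))\<^sup>2 / 2))"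
    by (simp only: exp_add [symmetric])
  then show ?thesis
    by (simp add: normal_density_def)
qed

lemma nn_integral_normal_density_eq_1:
  assumes "\<sigma> > 0"
  shows "(\<integral>\<^sup>+x. ennreal (normal_density \<mu> \<sigma> x) \<partial>lborel) = 1"
  using prob_space.emeasure_space_1[OF prob_space_normal_density[OF assms, of \<mu>]]
  by (simp add: emeasure_density)

lemma normal_mgf:
  "(\<integral>\<^sup>+x. ennreal (exp (l * (x - \<theta>))) \<partial>density lborel (normal_density \<theta> 1)) = ennreal (exp (l\<^sup>2 / 2))"
proof -
  have "(\<integral>\<^sup>+x. ennreal (exp (l * (x - \<theta>))) \<partial>density lborel (normal_density \<theta> 1))
      = (\<integral>\<^sup>+x. ennreal (exp (l\<^sup>2 / 2)) * ennreal (normal_density (\<theta> + l) 1 x) \<partial>lborel)"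
    by (subst nn_integral_density)
      (auto simp: ennreal_mult[symmetric] mult.commute[of "normal_density _ _ _"] normal_density_exp_tilt
        intro!: nn_integral_cong)
  also have "\<dots> = ennreal (exp (l\<^sup>2 / 2))"
    by (simp add: nn_integral_cmult nn_integral_normal_density_eq_1)
  finally show ?thesis .
qed

text \<open>Independence: the exponential of the sum is a product of functions of single
  coordinates, so its integral factors into \<open>n\<close> equal one-dimensional moments.\<close>

lemma sample_measure_mgf:
  "(\<integral>\<^sup>+y. ennreal (exp (l * (\<Sum>t=1..n. y t - \<theta>))) \<partial>sample_measure n \<theta>)
    = ennreal (exp (real n * l\<^sup>2 / 2))"
proof -
  interpret product_sigma_finite "\<lambda>_::nat. density lborel (normal_density \<theta> 1)"
    by (simp add: product_sigma_finite_def prob_space_imp_sigma_finite prob_space_normal_density)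
  have "(\<integral>\<^sup>+y. ennreal (exp (l * (\<Sum>t=1..n. y t - \<theta>))) \<partial>sample_measure n \<theta>)
      = (\<integral>\<^sup>+y. (\<Prod>t\<in>{1..n}. ennreal (exp (l * (y t - \<theta>)))) \<partial>sample_measure n \<theta>)"
    by (simp add: sum_distrib_left exp_sum prod_ennreal)
  also have "\<dots> = (\<Prod>t\<in>{1..n}. ennreal (exp (l\<^sup>2 / 2)))"
    unfolding sample_measure_def by (subst product_nn_integral_prod) (auto simp: normal_mgf)
  also have "\<dots> = ennreal (exp (real n * l\<^sup>2 / 2))"
    by (simp add: ennreal_power exp_of_nat_mult[symmetric])
  finally show ?thesis .
qed

text \<open>Markov's inequality for the exponential of
  \<open>real n * l * (sample_mean n y - \<theta>)\<close> at level \<open>exp (real n * u)\<close>.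
  The sign of \<open>l\<close> is left free so that one statement covers both tails.\<close>

lemma sample_mean_chernoff:
  assumes "n \<ge> 1"
  shows "\<P>(y in sample_measure n \<theta>. l * (sample_mean n y - \<theta>) \<ge> u)
    \<le> exp (real n * (l\<^sup>2 / 2 - u))"
proof -
  let ?M = "sample_measure n \<theta>"
  interpret prob_space ?M by (rule prob_space_sample_measure)
  have dev: "(\<Sum>t=1..n. y t - \<theta>) = real n * (sample_mean n y - \<theta>)" for y
    using assms by (simp add: sample_mean_def sum_subtractf right_diff_distrib)
  have meas: "(\<lambda>y. ennreal (exp (l * (\<Sum>t=1..n. y t - \<theta>)))) \<in> borel_measurable ?M"
    unfolding dev by measurable
  have "emeasure ?M {y \<in> space ?M. l * (sample_mean n y - \<theta>) \<ge> u}
      = (\<integral>\<^sup>+y. indicator {y \<in> space ?M. l * (sample_mean n y - \<theta>) \<ge> u} y \<partial>?M)"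
    by (subst nn_integral_indicator) auto
  also have "\<dots> \<le> (\<integral>\<^sup>+y. ennreal (exp (- (real n * u))) *
      ennreal (exp (l * (\<Sum>t=1..n. y t - \<theta>))) \<partial>?M)"
  \<comment> \<open>Markov's inequality pointwise: on the event the product of the two exponentials
    is at least 1, and off the event the indicator vanishes.\<close>
  proof (rule nn_integral_mono)
    fix y
    have "real n * u \<le> real n * (l * (sample_mean n y - \<theta>))" if "u \<le> l * (sample_mean n y - \<theta>)"
      using that by (intro mult_left_mono) auto
    then show "indicator {y \<in> space ?M. l * (sample_mean n y - \<theta>) \<ge> u} y
      \<le> ennreal (exp (- (real n * u))) * ennreal (exp (l * (\<Sum>t=1..n. y t - \<theta>)))"
      by (auto simp: indicator_def dev ennreal_mult[symmetric] exp_add[symmetric] ac_simps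
          simp del: One_nat_def)
  qed
  also have "\<dots> = ennreal (exp (- (real n * u))) * ennreal (exp (real n * l\<^sup>2 / 2))"
    by (subst nn_integral_cmult[OF meas]) (simp only: sample_measure_mgf)
  also have "\<dots> = ennreal (exp (real n * (l\<^sup>2 / 2 - u)))"
    by (simp add: ennreal_mult[symmetric] exp_add[symmetric] algebra_simps)
  finally show ?thesis
    by (simp add: emeasure_eq_measure)
qed

text \<open>Union bound over the two one-sided deviations. For a deviation \<open>t\<close> the
  Chernoff exponent \<open>l\<^sup>2 / 2 - l * t\<close> is minimal at \<open>l = t\<close>, with
  value \<open>- t\<^sup>2 / 2\<close>; the lower tail uses \<open>l = - t\<close>.\<close>

lemma sample_mean_tail:
  assumes "n \<ge> 1" "t \<ge> 0"
  shows "\<P>(y in sample_measure n \<theta>. \<bar>sample_mean n y - \<theta>\<bar> \<ge> t) \<le> 2 * exp (- (real n * t\<^sup>2 / 2))"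
proof -
  let ?M = "sample_measure n \<theta>"
  let ?A = "\<lambda>l. {y \<in> space ?M. l * (sample_mean n y - \<theta>) \<ge> t\<^sup>2}"
  interpret prob_space ?M by (rule prob_space_sample_measure)
  have "{y \<in> space ?M. \<bar>sample_mean n y - \<theta>\<bar> \<ge> t} \<subseteq> ?A t \<union> ?A (- t)"
  proof
    fix y assume "y \<in> {y \<in> space ?M. \<bar>sample_mean n y - \<theta>\<bar> \<ge> t}"
    \<comment> \<open>Multiplying by \<open>t\<close> instead of dividing treats
      \<open>t = 0\<close> together with \<open>t > 0\<close>.\<close>
    then have "y \<in> space ?M" "t * t \<le> t * \<bar>sample_mean n y - \<theta>\<bar>"
      using assms(2) by (auto intro: mult_left_mono)
    then show "y \<in> ?A t \<union> ?A (- t)"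
      by (cases "sample_mean n y \<ge> \<theta>") (auto simp: power2_eq_square algebra_simps)
  qed
  then have "prob {y \<in> space ?M. \<bar>sample_mean n y - \<theta>\<bar> \<ge> t} \<le> prob (?A t \<union> ?A (- t))"
    by (intro finite_measure_mono) auto
  also have "\<dots> \<le> prob (?A t) + prob (?A (- t))"
    by (intro measure_Un_le) auto
  also have "\<dots> \<le> 2 * exp (- (real n * t\<^sup>2 / 2))"
    using sample_mean_chernoff[OF assms(1), where l=t and u="t\<^sup>2" and \<theta>=\<theta>]
      sample_mean_chernoff[OF assms(1), where l="-t" and u="t\<^sup>2" and \<theta>=\<theta>]
    by (simp add: field_simps)
  finally show ?thesis .
qed

section \<open>Distance of the estimators from the sample mean\<close>

lemma soft_threshold_dist:
  fixes x h :: real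
  assumes "h > 0"
  shows "\<bar>sgn x * max (\<bar>x\<bar> - h) 0 - x\<bar> \<le> h"
  using assms by (auto simp: sgn_if max_def)

text \<open>The difference has absolute value \<open>(a * h - \<bar>x\<bar>) / (a - 2)\<close>. This
  decreases in \<open>\<bar>x\<bar>\<close> and equals \<open>h\<close> at the left end
  \<open>\<bar>x\<bar> = 2 * h\<close>.\<close>

lemma scad_interpolation_dist:
  fixes a h x :: real
  assumes "a > 2" "h > 0" "2 * h < \<bar>x\<bar>" "\<bar>x\<bar> \<le> a * h"
  shows "\<bar>((a - 1) * x - sgn x * a * h) / (a - 2) - x\<bar> \<le> h"
proof -
  have "((a - 1) * x - sgn x * a * h) / (a - 2) - x = (x - sgn x * a * h) / (a - 2)"
    using assms(1) by (simp add: divide_simps) (simp add: algebra_simps)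
  moreover have "\<bar>x - sgn x * a * h\<bar> \<le> h * (a - 2)"
    using assms by (auto simp: sgn_if abs_if algebra_simps split: if_splits)
  ultimately show ?thesis
    using assms(1) by (simp add: abs_divide divide_le_eq)
qed

lemma estimator_dist_sample_mean:
  assumes "\<eta> n > 0" "a > 2" "est \<in> {hard_threshold \<eta>, soft_threshold \<eta>, scad a \<eta>}"
  shows "\<bar>est n y - sample_mean n y\<bar> \<le> \<eta> n"
proof -
  consider "est = hard_threshold \<eta>" | "est = soft_threshold \<eta>" | "est = scad a \<eta>"
    using assms(3) by blast
  then show ?thesis
  proof cases
    case 1
    then show ?thesis using assms(1) by (simp add: hard_threshold_def of_bool_def)
  next
    case 2
    then show ?thesis using soft_threshold_dist[OF assms(1)] by (simp add: soft_threshold_def)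
  next
    case 3
    then show ?thesis
      using assms(1) soft_threshold_dist[OF assms(1)] scad_interpolation_dist[OF assms(2,1)]
      by (simp add: scad_def)
  qed
qed

text \<open>Of an error of at least \<open>t + \<eta> n\<close>, thresholding accounts for at most
  \<open>\<eta> n\<close>, so the sample mean must be off by at least \<open>t\<close>. The scale
  \<open>c\<close> and level \<open>M\<close> stay general to serve both the unscaled and the rate
  statement.\<close>

lemma estimator_tail:
  assumes "\<eta> n > 0" "a > 2" "est \<in> {hard_threshold \<eta>, soft_threshold \<eta>, scad a \<eta>}"
    and "n \<ge> 1" "t \<ge> 0" "\<And>x. c * x > M \<Longrightarrow> x \<ge> t + \<eta> n"
  shows "\<P>(y in sample_measure n \<theta>. c * \<bar>est n y - \<theta>\<bar> > M) \<le> 2 * exp (- (real n * t\<^sup>2 / 2))"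
proof -
  interpret prob_space "sample_measure n \<theta>" by (rule prob_space_sample_measure)
  have "\<P>(y in sample_measure n \<theta>. c * \<bar>est n y - \<theta>\<bar> > M)
      \<le> \<P>(y in sample_measure n \<theta>. \<bar>sample_mean n y - \<theta>\<bar> \<ge> t)"
  proof (intro finite_measure_mono subsetI)
    fix y assume y: "y \<in> {y \<in> space (sample_measure n \<theta>). c * \<bar>est n y - \<theta>\<bar> > M}"
    then have "\<bar>est n y - \<theta>\<bar> \<ge> t + \<eta> n"
      using assms(6) by blast
    with y show "y \<in> {y \<in> space (sample_measure n \<theta>). \<bar>sample_mean n y - \<theta>\<bar> \<ge> t}"
      using estimator_dist_sample_mean[OF assms(1-3), of y] by auto
  qed auto
  also have "\<dots> \<le> 2 * exp (- (real n * t\<^sup>2 / 2))"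
    by (rule sample_mean_tail[OF assms(4,5)])
  finally show ?thesis .
qed

section \<open>Uniform consistency and its rates\<close>

text \<open>Once \<open>\<eta> n\<close> is below \<open>\<epsilon> / 2\<close>, the other half of
  \<open>\<epsilon>\<close> is left to the sample mean and the tail bound applies. The finitely many
  earlier \<open>n\<close> are absorbed into the constant.\<close>

lemma uniform_exponential_consistency:
  assumes "\<And>n. n \<ge> 1 \<Longrightarrow> \<eta> n > 0" "\<eta> \<longlonglongrightarrow> 0" "a > 2"
    and "est \<in> {hard_threshold \<eta>, soft_threshold \<eta>, scad a \<eta>}" and "\<epsilon> > 0"
  shows "\<exists>C>0. \<exists>\<kappa>>0. \<forall>n\<ge>1.
    (SUP \<theta>::real. \<P>(y in sample_measure n \<theta>. \<bar>est n y - \<theta>\<bar> > \<epsilon>)) \<le> C * exp (- \<kappa> * real n)"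
proof -
  have "\<forall>\<^sub>F n in sequentially. \<eta> n < \<epsilon> / 2"
    using assms(2,5) by (intro order_tendstoD) auto
  then obtain N where N: "\<eta> n < \<epsilon> / 2" if "n \<ge> N" for n
    by (auto simp: eventually_sequentially)
  \<comment> \<open>This is the tail exponent \<open>t\<^sup>2 / 2\<close> at
    \<open>t = \<epsilon> / 2\<close>.\<close>
  define \<kappa> where "\<kappa> = \<epsilon>\<^sup>2 / 8"
  have "\<kappa> > 0" using assms(5) by (simp add: \<kappa>_def)
  \<comment> \<open>The 2 comes from the two-sided tail; the exponential factor makes the bound
    exceed the trivial bound 1 for every \<open>n < N\<close>.\<close>
  define C where "C = 2 * exp (\<kappa> * real N)"
  have "(SUP \<theta>::real. \<P>(y in sample_measure n \<theta>. \<bar>est n y - \<theta>\<bar> > \<epsilon>)) \<le> C * exp (- \<kappa> * real n)"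
    if "n \<ge> 1" for n
  proof (rule cSUP_least)
    fix \<theta> :: real
    show "\<P>(y in sample_measure n \<theta>. \<bar>est n y - \<theta>\<bar> > \<epsilon>) \<le> C * exp (- \<kappa> * real n)"
    proof (cases "n \<ge> N")
      case True
      have "\<P>(y in sample_measure n \<theta>. 1 * \<bar>est n y - \<theta>\<bar> > \<epsilon>)
          \<le> 2 * exp (- (real n * (\<epsilon> / 2)\<^sup>2 / 2))"
        using N[OF True] assms(5) that by (intro estimator_tail[OF assms(1,3,4)]) auto
      also have "\<dots> = 2 * exp (- \<kappa> * real n)"
        by (simp add: \<kappa>_def power_divide)
      also have "\<dots> \<le> C * exp (- \<kappa> * real n)"
        using \<open>\<kappa> > 0\<close> by (simp add: C_def)
      finally show ?thesis by simp
    next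
      case False
      have "\<P>(y in sample_measure n \<theta>. \<bar>est n y - \<theta>\<bar> > \<epsilon>) \<le> 1"
        by (rule prob_sample_measure_bounds)
      also have "1 \<le> exp (\<kappa> * real N + - \<kappa> * real n)"
        using False \<open>\<kappa> > 0\<close> by simp
      also have "\<dots> \<le> C * exp (- \<kappa> * real n)"
        unfolding C_def exp_add by simp
      finally show ?thesis .
    qed
  qed simp
  moreover have "C > 0" by (simp add: C_def)
  ultimately show ?thesis using \<open>\<kappa> > 0\<close> by blast
qed

text \<open>With \<open>t = m / sqrt (real n)\<close>, the scale is at most
  \<open>sqrt (real n)\<close>, so \<open>t\<close> contributes at most \<open>m\<close>; it is at
  most \<open>1 / \<eta> n\<close>, so thresholding contributes at most 1. Hence the level
  \<open>m + 1\<close> and a tail bound free of \<open>n\<close> and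
  \<open>\<theta>\<close>.\<close>

lemma uniform_rate_consistency:
  assumes "\<And>n. n \<ge> 1 \<Longrightarrow> \<eta> n > 0" "a > 2"
    and "est \<in> {hard_threshold \<eta>, soft_threshold \<eta>, scad a \<eta>}" and "\<epsilon> > 0"
  shows "\<exists>M\<ge>0. (SUP n\<in>{1..}. SUP \<theta>::real. \<P>(y in sample_measure n \<theta>.
    min (sqrt (real n)) (1 / \<eta> n) * \<bar>est n y - \<theta>\<bar> > M)) < \<epsilon>"
proof (intro exI conjI)
  \<comment> \<open>Chosen so that \<open>m\<^sup>2 / 2 = 2 / \<epsilon>\<close>; then
    \<open>2 * exp (- (m\<^sup>2 / 2)) < \<epsilon>\<close> follows from \<open>x < exp x\<close> at
    \<open>x = 2 / \<epsilon>\<close>.\<close>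
  define m where "m = sqrt (4 / \<epsilon>)"
  have m: "m > 0" "m\<^sup>2 = 4 / \<epsilon>" using assms(4) by (auto simp: m_def)
  show "m + 1 \<ge> 0" using m by simp
  have "(SUP n\<in>{1..}. SUP \<theta>::real. \<P>(y in sample_measure n \<theta>.
      min (sqrt (real n)) (1 / \<eta> n) * \<bar>est n y - \<theta>\<bar> > m + 1)) \<le> 2 * exp (- (m\<^sup>2 / 2))"
  proof (intro cSUP_least)
    fix n :: nat and \<theta> :: real
    assume "n \<in> {1..}"
    then have n: "n \<ge> 1" "sqrt (real n) > 0" by auto
    let ?c = "min (sqrt (real n)) (1 / \<eta> n)"
    have pos: "\<eta> n > 0" using assms(1) n by simp
    have c: "?c > 0" using n pos by simp
    have "x \<ge> m / sqrt (real n) + \<eta> n" if "?c * x > m + 1" for x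
    proof -
      have "?c * (m / sqrt (real n)) \<le> sqrt (real n) * (m / sqrt (real n))"
        using n m by (intro mult_right_mono) auto
      moreover have "?c * \<eta> n \<le> 1 / \<eta> n * \<eta> n"
        using pos by (intro mult_right_mono) auto
      ultimately have "?c * (m / sqrt (real n) + \<eta> n) \<le> m + 1"
        using n pos by (simp add: distrib_left)
      with that have "?c * (m / sqrt (real n) + \<eta> n) < ?c * x" by linarith
      with c show ?thesis by (simp only: mult_less_cancel_left_pos)
    qed
    then have "\<P>(y in sample_measure n \<theta>. ?c * \<bar>est n y - \<theta>\<bar> > m + 1)
        \<le> 2 * exp (- (real n * (m / sqrt (real n))\<^sup>2 / 2))"
      using n m by (intro estimator_tail[OF pos assms(2,3)]) auto
    then show "\<P>(y in sample_measure n \<theta>. ?c * \<bar>est n y - \<theta>\<bar> > m + 1) \<le> 2 * exp (- (m\<^sup>2 / 2))"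
      using n by (simp add: power_divide)
  qed auto
  also have "\<dots> < \<epsilon>"
  proof -
    have "2 / \<epsilon> < exp (2 / \<epsilon>)"
      using exp_ge_add_one_self[of "2 / \<epsilon>"] by linarith
    then show ?thesis
      using assms(4) by (simp add: m exp_minus field_simps)
  qed
  finally show "(SUP n\<in>{1..}. SUP \<theta>::real. \<P>(y in sample_measure n \<theta>.
      min (sqrt (real n)) (1 / \<eta> n) * \<bar>est n y - \<theta>\<bar> > m + 1)) < \<epsilon>" .
qed

theorem theorem2:
  fixes \<eta> :: "nat \<Rightarrow> real" and a :: real
    and est :: "nat \<Rightarrow> (nat \<Rightarrow> real) \<Rightarrow> real"
  assumes eta_pos: "\<And>n. n \<ge> 1 \<Longrightarrow> \<eta> n > 0"
    and eta_lim: "\<eta> \<longlonglongrightarrow> 0"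
    and a: "a > 2"
    and est: "est \<in> {hard_threshold \<eta>, soft_threshold \<eta>, scad a \<eta>}"
  shows "(\<forall>\<epsilon>>0.
            (\<lambda>n. SUP \<theta>::real. \<P>(y in sample_measure n \<theta>. \<bar>est n y - \<theta>\<bar> > \<epsilon>)) \<longlonglongrightarrow> 0)
       \<and> (\<forall>\<epsilon>>0. \<exists>C>0. \<exists>\<kappa>>0. \<forall>n\<ge>1.
            (SUP \<theta>::real. \<P>(y in sample_measure n \<theta>. \<bar>est n y - \<theta>\<bar> > \<epsilon>))
              \<le> C * exp (- \<kappa> * real n))
       \<and> (\<forall>\<epsilon>>0. \<exists>M\<ge>0.
            (SUP n\<in>{1..}. SUP \<theta>::real.
               \<P>(y in sample_measure n \<theta>.
                  min (sqrt (real n)) (1 / \<eta> n) * \<bar>est n y - \<theta>\<bar> > M)) < \<epsilon>)"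
proof (intro conjI allI impI)
  fix \<epsilon> :: real assume "\<epsilon> > 0"
  \<comment> \<open>The exponential bound is the second claim and also yields the first, by
    squeezing the supremum between 0 and a null sequence.\<close>
  note exp_bound = uniform_exponential_consistency[OF assms \<open>\<epsilon> > 0\<close>]
  let ?S = "\<lambda>n. SUP \<theta>::real. \<P>(y in sample_measure n \<theta>. \<bar>est n y - \<theta>\<bar> > \<epsilon>)"
  from exp_bound obtain C \<kappa> where "\<kappa> > 0"
    and bound: "\<And>n. n \<ge> 1 \<Longrightarrow> ?S n \<le> C * exp (- \<kappa> * real n)"
    by blast
  have upper: "\<forall>\<^sub>F n in sequentially. ?S n \<le> C * exp (- \<kappa> * real n)"
    using bound by (rule eventually_sequentiallyI)
  \<comment> \<open>A real supremum dominates its members only over a set bounded above, here by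
    1.\<close>
  have lower: "\<forall>\<^sub>F n in sequentially. 0 \<le> ?S n"
    by (intro always_eventually allI cSUP_upper2[where x=0]) (auto intro!: bdd_aboveI2 prob_sample_measure_bounds)
  have lim: "(\<lambda>n. C * exp (- \<kappa> * real n)) \<longlonglongrightarrow> 0"
  proof -
    \<comment> \<open>The bound is read as a geometric sequence with ratio
      \<open>exp (- \<kappa>) < 1\<close>.\<close>
    have "(\<lambda>n. C * exp (- \<kappa>) ^ n) \<longlonglongrightarrow> C * 0"
      using \<open>\<kappa> > 0\<close> by (intro tendsto_intros LIMSEQ_power_zero) simp
    then show ?thesis by (simp only: exp_of_nat2_mult mult_zero_right)
  qed
  show "?S \<longlonglongrightarrow> 0"
    by (rule tendsto_sandwich[OF lower upper tendsto_const lim])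
  show "\<exists>C>0. \<exists>\<kappa>>0. \<forall>n\<ge>1. ?S n \<le> C * exp (- \<kappa> * real n)"
    by (rule exp_bound)
  show "\<exists>M\<ge>0. (SUP n\<in>{1..}. SUP \<theta>::real. \<P>(y in sample_measure n \<theta>.
      min (sqrt (real n)) (1 / \<eta> n) * \<bar>est n y - \<theta>\<bar> > M)) < \<epsilon>"
    by (rule uniform_rate_consistency[OF eta_pos a est \<open>\<epsilon> > 0\<close>])
qed

end
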